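(* Let $\Delta$ be a finite abstract simplicial complex of dimension $d-1$ with $\tilde f$-polynomial $\tilde f(x)$ and $\tilde h$-polynomial $\tilde h(x)$. Then $$(x+1)^d\,\tilde h\left(\frac{x}{x+1}\right)=\tilde f(x).$$
   Context: A simplicial complex $\Delta$ is a finite collection of finite sets (faces), containing the empty face, closed under taking subsets. The dimension of a face $F$ is $|F|-1$, and the dimension $d-1$ of $\Delta$ is the largest dimension of a face. For $0\le i\le d-1$ let $f_i$ be the number of $i$-dimensional faces of $\Delta$, and $f_{-1}=1$ (the empty face). The numbers $h_0,\dots,h_d$ are defined by the polynomial identity $\sum_{i=0}^{d}h_i x^i=\sum_{i=0}^{d}f_{i-1}x^i(1-x)^{d-i}$. The polynomials are $\tilde f(x)=\sum_{i=0}^d f_{i-1}x^i$ and $\tilde h(x)=\sum_{i=0}^d h_i x^i$. The identity is one of rational functions in the variable $x$. *)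

theory Defs
  imports
    "HOL-Computational_Algebra.Polynomial"
    "HOL-Computational_Algebra.Fraction_Field"
begin

definition abstract_simplicial_complex :: "'a set set \<Rightarrow> bool" where
  "abstract_simplicial_complex \<Delta> \<longleftrightarrow>
     finite \<Delta> \<and> (\<forall>F\<in>\<Delta>. finite F) \<and> {} \<in> \<Delta> \<and> (\<forall>F\<in>\<Delta>. \<forall>G. G \<subseteq> F \<longrightarrow> G \<in> \<Delta>)"

text \<open>Dimensions are integers, as the empty face has dimension \<open>-1\<close>.\<close>

definition face_dim :: "'a set \<Rightarrow> int" where
  "face_dim F = int (card F) - 1"

definition complex_dim :: "'a set set \<Rightarrow> int" where
  "complex_dim \<Delta> = Max (face_dim ` \<Delta>)"

definition f_num :: "'a set set \<Rightarrow> int \<Rightarrow> nat" where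
  "f_num \<Delta> i = card {F \<in> \<Delta>. face_dim F = i}"

text \<open>The number \<open>d\<close> such that the complex has dimension \<open>d - 1\<close>.\<close>

definition complex_rank :: "'a set set \<Rightarrow> nat" where
  "complex_rank \<Delta> = nat (complex_dim \<Delta> + 1)"

definition f_poly :: "'a set set \<Rightarrow> int poly" where
  "f_poly \<Delta> = (\<Sum>i\<le>complex_rank \<Delta>. monom (int (f_num \<Delta> (int i - 1))) i)"

text \<open>The right-hand side of the identity defining the \<open>h\<close>-numbers,
  namely the sum of \<open>f_{i-1} x^i (1-x)^{d-i}\<close>.\<close>

definition h_gen :: "'a set set \<Rightarrow> int poly" where
  "h_gen \<Delta> = (\<Sum>i\<le>complex_rank \<Delta>.
     smult (int (f_num \<Delta> (int i - 1))) ([:0, 1:] ^ i * [:1, -1:] ^ (complex_rank \<Delta> - i)))"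

definition h_num :: "'a set set \<Rightarrow> nat \<Rightarrow> int" where
  "h_num \<Delta> i = coeff (h_gen \<Delta>) i"

definition h_poly :: "'a set set \<Rightarrow> int poly" where
  "h_poly \<Delta> = (\<Sum>i\<le>complex_rank \<Delta>. monom (h_num \<Delta> i) i)"

text \<open>The defining identity holds: \<open>h_gen\<close> has degree at most \<open>d\<close>, so that no
  coefficient is lost. Moreover it determines \<open>h_0, ..., h_d\<close>.\<close>

lemma h_poly_eq_h_gen: "h_poly \<Delta> = h_gen \<Delta>"
proof -
  let ?d = "complex_rank \<Delta>"
  have "degree (h_gen \<Delta>) \<le> ?d"
    unfolding h_gen_def
  proof (rule degree_sum_le)
    fix i assume i: "i \<in> {..?d}"
    have "degree ([:0, 1::int:] ^ i * [:1, -1:] ^ (?d - i)) \<le> i + (?d - i)"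
      by (intro order.trans[OF degree_mult_le] add_mono order.trans[OF degree_power_le]) auto
    then show "degree (smult (int (f_num \<Delta> (int i - 1)))
        ([:0, 1:] ^ i * [:1, -1:] ^ (?d - i))) \<le> ?d"
      using i degree_smult_le order.trans by fastforce
  qed auto
  then show ?thesis
    unfolding h_poly_def h_num_def
    by (rule poly_as_sum_of_monoms')
qed

lemma h_num_unique:
  assumes "(\<Sum>i\<le>complex_rank \<Delta>. monom (c i) i) = h_gen \<Delta>" "i \<le> complex_rank \<Delta>"
  shows "c i = h_num \<Delta> i"
  unfolding h_num_def assms(1)[symmetric]
  using assms(2) by (simp add: coeff_sum)

lemma f_num_empty_face:
  assumes "abstract_simplicial_complex \<Delta>"
  shows "f_num \<Delta> (-1) = 1"
proof -
  have "{F \<in> \<Delta>. face_dim F = -1} = {{}}"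
    using assms by (auto simp: abstract_simplicial_complex_def face_dim_def)
  then show ?thesis by (simp add: f_num_def)
qed

text \<open>The variable \<open>x\<close> of the field of rational functions over the rationals, and the value of
  an integer polynomial at a rational function.\<close>

definition ratfun_X :: "rat poly fract" where
  "ratfun_X = Fract [:0, 1:] 1"

definition ratfun_eval :: "int poly \<Rightarrow> rat poly fract \<Rightarrow> rat poly fract" where
  "ratfun_eval p r = poly (map_poly of_int p) r"

text \<open>Evaluation at the variable embeds the integer polynomials into the rational functions.\<close>

lemma ratfun_eval_X: "ratfun_eval p ratfun_X = Fract (map_poly of_int p) 1"
proof (induction p)
  case 0
  show ?case by (simp add: ratfun_eval_def Zero_fract_def)
next
  case (pCons a p)
  have of_nat_fract: "of_nat n = (Fract [:of_nat n:] 1 :: rat poly fract)" for n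
    by (induction n) (simp_all add: Zero_fract_def One_fract_def one_pCons)
  have of_int_fract: "of_int k = (Fract [:of_int k:] 1 :: rat poly fract)" for k
    by (cases k rule: int_cases2) (simp_all add: of_nat_fract)
  have "ratfun_eval (pCons a p) ratfun_X = of_int a + ratfun_X * ratfun_eval p ratfun_X"
    by (simp add: ratfun_eval_def map_poly_pCons)
  then show ?case
    unfolding pCons.IH by (simp add: map_poly_pCons ratfun_X_def of_int_fract)
qed

end

theory Submission
  imports Defs
begin

text \<open>The substitution \<open>y = x / (x + 1)\<close> satisfies \<open>1 - y = 1 / (x + 1)\<close>. Hence multiplication by
  \<open>(x + 1)^d\<close> turns each term \<open>y^i (1 - y)^(d - i)\<close> of the identity that defines the \<open>h\<close>-numbers
  into \<open>x^i\<close>, because the \<open>d\<close> factors \<open>x + 1\<close> cancel exactly the \<open>i + (d - i)\<close> denominators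
  (\<open>clear_denominators\<close>). What remains is the sum of the \<open>f_{i-1} x^i\<close>. To apply this term
  by term, evaluation of integer polynomials must be a ring homomorphism, and \<open>x + 1\<close> must be
  nonzero as a rational function.\<close>

lemma ratfun_eval_0 [simp]: "ratfun_eval 0 r = 0"
  by (simp add: ratfun_eval_def)

lemma ratfun_eval_pCons [simp]: "ratfun_eval (pCons a p) r = of_int a + r * ratfun_eval p r"
  by (simp add: ratfun_eval_def map_poly_pCons)

lemma ratfun_eval_1 [simp]: "ratfun_eval 1 r = 1"
  by (simp add: one_pCons)

lemma ratfun_eval_add: "ratfun_eval (p + q) r = ratfun_eval p r + ratfun_eval q r"
  by (induction p q rule: poly_induct2) (simp_all add: algebra_simps)

lemma ratfun_eval_smult: "ratfun_eval (smult a p) r = of_int a * ratfun_eval p r"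
  by (induction p) (simp_all add: algebra_simps)

lemma ratfun_eval_mult: "ratfun_eval (p * q) r = ratfun_eval p r * ratfun_eval q r"
  by (induction p) (simp_all add: ratfun_eval_add ratfun_eval_smult algebra_simps)

lemma ratfun_eval_power: "ratfun_eval (p ^ n) r = ratfun_eval p r ^ n"
  by (induction n) (simp_all add: ratfun_eval_mult)

lemma ratfun_eval_sum: "ratfun_eval (\<Sum>i\<in>A. p i) r = (\<Sum>i\<in>A. ratfun_eval (p i) r)"
  by (induction A rule: infinite_finite_induct) (simp_all add: ratfun_eval_add)

lemma ratfun_eval_monom: "ratfun_eval (monom a n) r = of_int a * r ^ n"
  by (induction n) (simp_all add: monom_0 monom_Suc)

lemma ratfun_eval_f_poly:
  "ratfun_eval (f_poly \<Delta>) r =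
     (\<Sum>i\<le>complex_rank \<Delta>. of_int (int (f_num \<Delta> (int i - 1))) * r ^ i)"
  by (simp only: f_poly_def ratfun_eval_sum ratfun_eval_monom)

lemma ratfun_eval_h_poly:
  "ratfun_eval (h_poly \<Delta>) r =
     (\<Sum>i\<le>complex_rank \<Delta>. of_int (int (f_num \<Delta> (int i - 1))) *
        (r ^ i * (1 - r) ^ (complex_rank \<Delta> - i)))"
proof -
  have "ratfun_eval [:0, 1:] r = r" "ratfun_eval [:1, -1:] r = 1 - r"
    by simp_all
  then show ?thesis
    by (simp only: h_poly_eq_h_gen h_gen_def ratfun_eval_sum ratfun_eval_smult
        ratfun_eval_mult ratfun_eval_power)
qed

lemma clear_denominators:
  fixes x :: "'a::field"
  assumes "x + 1 \<noteq> 0" "i \<le> d"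
  shows "(x + 1) ^ d * ((x / (x + 1)) ^ i * (1 - x / (x + 1)) ^ (d - i)) = x ^ i"
proof -
  have "1 - x / (x + 1) = 1 / (x + 1)"
    using assms(1) by (simp add: field_simps)
  moreover have "(x + 1) ^ d = (x + 1) ^ i * (x + 1) ^ (d - i)"
    using assms(2) by (simp flip: power_add)
  ultimately show ?thesis
    using assms(1) by (simp add: power_divide)
qed

lemma ratfun_X_plus_1_neq_0: "ratfun_X + 1 \<noteq> 0"
proof -
  have "ratfun_X + 1 = Fract [:1, 1:] 1"
    by (simp add: ratfun_X_def One_fract_def one_pCons)
  then show ?thesis
    by (simp add: Zero_fract_def eq_fract)
qed

theorem theorem2p1:
  fixes \<Delta> :: "'a set set" and d :: nat
  assumes "abstract_simplicial_complex \<Delta>"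
    and "complex_dim \<Delta> = int d - 1"
  shows "(ratfun_X + 1) ^ d * ratfun_eval (h_poly \<Delta>) (ratfun_X / (ratfun_X + 1))
           = ratfun_eval (f_poly \<Delta>) ratfun_X"
proof -
  let ?y = "ratfun_X / (ratfun_X + 1)"
  let ?f = "\<lambda>i. of_int (int (f_num \<Delta> (int i - 1))) :: rat poly fract"
  have rank: "complex_rank \<Delta> = d"
    by (simp add: complex_rank_def assms(2))
  have "(ratfun_X + 1) ^ d * ratfun_eval (h_poly \<Delta>) ?y
      = (\<Sum>i\<le>d. ?f i * ((ratfun_X + 1) ^ d * (?y ^ i * (1 - ?y) ^ (d - i))))"
    unfolding ratfun_eval_h_poly rank sum_distrib_left
    by (intro sum.cong refl mult.left_commute)
  also have "\<dots> = (\<Sum>i\<le>d. ?f i * ratfun_X ^ i)"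
    by (intro sum.cong refl arg_cong2[where f = "(*)"]
        clear_denominators ratfun_X_plus_1_neq_0) simp
  also have "\<dots> = ratfun_eval (f_poly \<Delta>) ratfun_X"
    unfolding ratfun_eval_f_poly rank ..
  finally show ?thesis .
qed

end
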